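(* Let $\varphi$ and $\psi$ be bounded analytic functions on the open unit disc $\mathbb{U}$. Suppose $\varphi$ singly covers a nonvoid open subset of $\varphi(\mathbb{U})$ that has nonempty intersection with $\psi(\mathbb{U})$. If $T_\varphi\propto T_\psi$, then $\psi$ is subordinate to $\varphi$; in particular, $\psi(\mathbb{U})\subset\varphi(\mathbb{U})$.
   Context: $\mathbb{U}$ is the open unit disc in $\mathbb{C}$ and $H^2$ is the Hardy space of $\mathbb{U}$. For a bounded analytic function $\varphi$ on $\mathbb{U}$, $T_\varphi:H^2\to H^2$ is the analytic Toeplitz operator $T_\varphi h=\varphi h$. For bounded linear operators $A,B$ on a Hilbert space $\mathcal{H}$, $A\propto B$ means that there is a nonzero bounded linear operator $X$ on $\mathcal{H}$ with $XA=BX$. "$\varphi$ singly covers a set $W$" means that $\varphi$ takes some set $V\subset\mathbb{U}$ univalently (injectively) onto $W$ with $\varphi^{-1}(W)=V$, where $\varphi^{-1}(W)=\{z\in\mathbb{U}:\varphi(z)\in W\}$. "$\psi$ is subordinate to $\varphi$" means that there is a holomorphic map $\omega:\mathbb{U}\to\mathbb{U}$ with $\psi=\varphi\circ\omega$ (it is not required that $\omega(0)=0$). *)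

theory Defs
  imports "HOL-Complex_Analysis.Complex_Analysis"
begin

section \<open>Maclaurin coefficients on the unit disc\<close>

abbreviation unit_disc :: "complex set" (\<open>\<U>\<close>)
  where "\<U> \<equiv> ball 0 1"

definition maclaurin :: "(complex \<Rightarrow> complex) \<Rightarrow> nat \<Rightarrow> complex"
  where "maclaurin f n = fps_nth (fps_expansion f 0) n"

lemma maclaurin_altdef: "maclaurin f n = (deriv ^^ n) f 0 / fact n"
  by (simp add: maclaurin_def fps_expansion_def)

lemma maclaurin_add:
  "f holomorphic_on \<U> \<Longrightarrow> g holomorphic_on \<U> \<Longrightarrow>
     maclaurin (\<lambda>z. f z + g z) n = maclaurin f n + maclaurin g n"
  by (simp add: maclaurin_altdef higher_deriv_add[of f "\<U>" g] add_divide_distrib)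

lemma maclaurin_cmult:
  "f holomorphic_on \<U> \<Longrightarrow> maclaurin (\<lambda>z. c * f z) n = c * maclaurin f n"
  by (simp add: maclaurin_altdef higher_deriv_cmult[of f "\<U>"])

lemma maclaurin_zero [simp]: "maclaurin (\<lambda>z. 0) n = 0"
  using maclaurin_cmult[of "\<lambda>z. 0" 0 n] by simp

lemma maclaurin_cong:
  assumes "\<And>z. z \<in> \<U> \<Longrightarrow> f z = g z"
  shows "maclaurin f n = maclaurin g n"
proof -
  have "\<forall>\<^sub>F w in nhds 0. f w = g w"
    using assms eventually_nhds_in_open[of "\<U>" 0] by (auto elim: eventually_mono)
  then show ?thesis
    unfolding maclaurin_def by (metis fps_expansion_cong)
qed

lemma maclaurin_sums:
  "f holomorphic_on \<U> \<Longrightarrow> z \<in> \<U> \<Longrightarrow> (\<lambda>n. maclaurin f n * z ^ n) sums f z"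
  using holomorphic_power_series[of f 0 1 z] by (simp add: maclaurin_altdef)

section \<open>The Hardy space \<open>H\<^sup>2\<close>\<close>

text \<open>Functions on the disc are total functions here, so an element of the Hardy space is
  represented by its extension by 0 to the whole plane.\<close>

typedef hardy2 =
  "{f. f holomorphic_on \<U> \<and> (\<forall>z. z \<notin> \<U> \<longrightarrow> f z = 0) \<and>
       summable (\<lambda>n. (cmod (maclaurin f n))\<^sup>2)}"
  morphisms hardy2_fun Abs_hardy2
  by (rule exI[of _ "\<lambda>z. 0"]) simp

setup_lifting type_definition_hardy2

lemma hardy2_holomorphic: "hardy2_fun f holomorphic_on \<U>"
  by transfer simp

lemma hardy2_summable: "summable (\<lambda>n. (cmod (maclaurin (hardy2_fun f) n))\<^sup>2)"
  by transfer simp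

lemma sum_sq_bound: "(cmod (a + b))\<^sup>2 \<le> 2 * (cmod a)\<^sup>2 + 2 * (cmod b)\<^sup>2"
proof -
  have "(cmod (a + b))\<^sup>2 \<le> (cmod a + cmod b)\<^sup>2"
    by (intro power_mono norm_triangle_ineq) auto
  also have "\<dots> \<le> 2 * (cmod a)\<^sup>2 + 2 * (cmod b)\<^sup>2"
    using sum_squares_bound[of "cmod a" "cmod b"] by (simp add: power2_sum)
  finally show ?thesis .
qed

lemma summable_sq_add:
  assumes "summable (\<lambda>n. (cmod (a n))\<^sup>2)" "summable (\<lambda>n. (cmod (b n))\<^sup>2)"
  shows "summable (\<lambda>n. (cmod (a n + b n))\<^sup>2)"
proof (rule summable_comparison_test')
  show "summable (\<lambda>n. 2 * (cmod (a n))\<^sup>2 + 2 * (cmod (b n))\<^sup>2)"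
    by (intro summable_add summable_mult assms)
qed (use sum_sq_bound in auto)

lemma summable_sq_cmult:
  assumes "summable (\<lambda>n. (cmod (a n))\<^sup>2)"
  shows "summable (\<lambda>n. (cmod (c * a n))\<^sup>2)"
  using summable_mult[OF assms, of "(cmod c)\<^sup>2"] by (simp add: norm_mult power_mult_distrib)

lemma summable_sq_prod:
  assumes "summable (\<lambda>n. (cmod (a n))\<^sup>2)" "summable (\<lambda>n. (cmod (b n))\<^sup>2)"
  shows "summable (\<lambda>n. a n * cnj (b n))"
proof (rule summable_comparison_test')
  show "summable (\<lambda>n. (cmod (a n))\<^sup>2 + (cmod (b n))\<^sup>2)"
    by (intro summable_add assms)
  fix n :: nat
  have "2 * (cmod (a n) * cmod (b n)) \<le> (cmod (a n))\<^sup>2 + (cmod (b n))\<^sup>2"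
    using sum_squares_bound[of "cmod (a n)" "cmod (b n)"] by simp
  moreover have "0 \<le> cmod (a n) * cmod (b n)" by simp
  ultimately show "cmod (a n * cnj (b n)) \<le> (cmod (a n))\<^sup>2 + (cmod (b n))\<^sup>2"
    unfolding norm_mult complex_mod_cnj by linarith
qed

text \<open>Scalar multiplication by complex numbers; Isabelle/HOL's type classes only cover the
  real scalars.\<close>

lift_definition scaleC_hardy2 :: "complex \<Rightarrow> hardy2 \<Rightarrow> hardy2" (infixr \<open>*\<^sub>C\<close> 75)
  is "\<lambda>c f z. c * f z"
  by (auto intro!: holomorphic_intros simp: maclaurin_cmult summable_sq_cmult)

instantiation hardy2 :: real_vector
begin

lift_definition zero_hardy2 :: hardy2 is "\<lambda>z. 0" by simp

lift_definition plus_hardy2 :: "hardy2 \<Rightarrow> hardy2 \<Rightarrow> hardy2" is "\<lambda>f g z. f z + g z"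
  by (auto intro!: holomorphic_intros simp: maclaurin_add summable_sq_add)

definition uminus_hardy2 :: "hardy2 \<Rightarrow> hardy2" where "- f = (-1) *\<^sub>C f"

definition minus_hardy2 :: "hardy2 \<Rightarrow> hardy2 \<Rightarrow> hardy2" where "f - g = f + (- g :: hardy2)"

definition scaleR_hardy2 :: "real \<Rightarrow> hardy2 \<Rightarrow> hardy2" where "r *\<^sub>R f = of_real r *\<^sub>C f"

instance
  by standard
     (unfold minus_hardy2_def uminus_hardy2_def scaleR_hardy2_def,
      (transfer, simp add: fun_eq_iff algebra_simps)+)

end

text \<open>The complex inner product \<open>\<langle>f, g\<rangle> = \<Sum>\<^sub>n a\<^sub>n \<cdot> cnj b\<^sub>n\<close> of \<open>H\<^sup>2\<close>; its real part is the
  inner product of the underlying real space, with the same norm.\<close>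

definition cinner_hardy2 :: "hardy2 \<Rightarrow> hardy2 \<Rightarrow> complex"
  where "cinner_hardy2 f g =
    (\<Sum>n. maclaurin (hardy2_fun f) n * cnj (maclaurin (hardy2_fun g) n))"

lemma maclaurin_hardy2_add [simp]:
  "maclaurin (hardy2_fun (f + g)) n = maclaurin (hardy2_fun f) n + maclaurin (hardy2_fun g) n"
  by (simp add: plus_hardy2.rep_eq maclaurin_add hardy2_holomorphic)

lemma maclaurin_hardy2_scaleC [simp]:
  "maclaurin (hardy2_fun (c *\<^sub>C f)) n = c * maclaurin (hardy2_fun f) n"
  by (simp add: scaleC_hardy2.rep_eq maclaurin_cmult hardy2_holomorphic)

lemma hardy2_summable_prod:
  "summable (\<lambda>n. maclaurin (hardy2_fun f) n * cnj (maclaurin (hardy2_fun g) n))"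
  by (intro summable_sq_prod hardy2_summable)

lemma cinner_hardy2_add_left:
  "cinner_hardy2 (f + g) h = cinner_hardy2 f h + cinner_hardy2 g h"
  using suminf_add[OF hardy2_summable_prod hardy2_summable_prod, of f h g h]
  by (simp add: cinner_hardy2_def algebra_simps)

lemma cinner_hardy2_scaleC_left: "cinner_hardy2 (c *\<^sub>C f) g = c * cinner_hardy2 f g"
  using suminf_mult[OF hardy2_summable_prod, of c f g]
  by (simp add: cinner_hardy2_def algebra_simps)

lemma cinner_hardy2_commute: "cinner_hardy2 f g = cnj (cinner_hardy2 g f)"
  using sums_unique[OF iffD2[OF sums_cnj, OF summable_sums[OF hardy2_summable_prod]], of g f]
  by (simp add: cinner_hardy2_def mult.commute)

lemma cinner_hardy2_self:
  "cinner_hardy2 f f = of_real (\<Sum>n. (cmod (maclaurin (hardy2_fun f) n))\<^sup>2)"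
  unfolding cinner_hardy2_def complex_norm_square[symmetric]
  using suminf_of_real[OF hardy2_summable, of f, where 'a = complex] by simp

lemma hardy2_eqI:
  assumes "\<And>n. maclaurin (hardy2_fun f) n = maclaurin (hardy2_fun g) n"
  shows "f = g"
proof -
  have "hardy2_fun f z = hardy2_fun g z" for z
  proof (cases "z \<in> \<U>")
    case True
    show ?thesis
      using maclaurin_sums[OF hardy2_holomorphic True, of f]
        maclaurin_sums[OF hardy2_holomorphic True, of g]
      by (simp add: assms sums_unique2)
  next
    case False
    then show ?thesis using hardy2_fun[of f] hardy2_fun[of g] by auto
  qed
  then show ?thesis by (metis hardy2_fun_inject ext)
qed

instantiation hardy2 :: real_inner
begin

definition inner_hardy2 :: "hardy2 \<Rightarrow> hardy2 \<Rightarrow> real"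
  where "inner_hardy2 f g = Re (cinner_hardy2 f g)"

definition norm_hardy2 :: "hardy2 \<Rightarrow> real"
  where "norm_hardy2 f = sqrt (\<Sum>n. (cmod (maclaurin (hardy2_fun f) n))\<^sup>2)"

definition sgn_hardy2 :: "hardy2 \<Rightarrow> hardy2"
  where "sgn_hardy2 f = f /\<^sub>R norm f"

definition dist_hardy2 :: "hardy2 \<Rightarrow> hardy2 \<Rightarrow> real"
  where "dist_hardy2 f g = norm (f - g)"

definition uniformity_hardy2 :: "(hardy2 \<times> hardy2) filter"
  where "uniformity_hardy2 = (INF e\<in>{0 <..}. principal {(x, y). dist x y < e})"

definition open_hardy2 :: "hardy2 set \<Rightarrow> bool"
  where "open_hardy2 S = (\<forall>x\<in>S. \<forall>\<^sub>F (x', y) in uniformity. x' = x \<longrightarrow> y \<in> S)"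

instance
proof
  fix f g h :: hardy2 and r :: real
  show "inner f g = inner g f"
    unfolding inner_hardy2_def by (subst cinner_hardy2_commute) simp
  show "inner (f + g) h = inner f h + inner g h"
    by (simp add: inner_hardy2_def cinner_hardy2_add_left)
  show "inner (r *\<^sub>R f) g = r * inner f g"
    by (simp add: inner_hardy2_def scaleR_hardy2_def cinner_hardy2_scaleC_left)
  show "0 \<le> inner f f"
    by (simp add: inner_hardy2_def cinner_hardy2_self suminf_nonneg hardy2_summable)
  show "norm f = sqrt (inner f f)"
    by (simp add: norm_hardy2_def inner_hardy2_def cinner_hardy2_self)
  show "inner f f = 0 \<longleftrightarrow> f = 0"
  proof
    assume "inner f f = 0"
    then have "\<forall>n. (cmod (maclaurin (hardy2_fun f) n))\<^sup>2 = 0"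
      using suminf_eq_zero_iff[OF hardy2_summable, of f]
      by (simp add: inner_hardy2_def cinner_hardy2_self)
    then show "f = 0" by (intro hardy2_eqI) (simp add: zero_hardy2.rep_eq)
  qed (simp add: inner_hardy2_def cinner_hardy2_self zero_hardy2.rep_eq)
qed (simp_all add: sgn_hardy2_def dist_hardy2_def uniformity_hardy2_def open_hardy2_def)

end

section \<open>Analytic Toeplitz operators\<close>

definition toeplitz :: "(complex \<Rightarrow> complex) \<Rightarrow> hardy2 \<Rightarrow> hardy2"
  where "toeplitz \<phi> h = Abs_hardy2 (\<lambda>z. if z \<in> \<U> then \<phi> z * hardy2_fun h z else 0)"

text \<open>The following shows that, for bounded analytic symbols, the function under
  \<^const>\<open>Abs_hardy2\<close> does lie in the Hardy space, and that the operator is bounded.\<close>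

lemma has_integral_cis:
  "((\<lambda>t. cis (of_int k * t)) has_integral (if k = 0 then of_real (2 * pi) else 0)) {0..2*pi}"
proof (cases "k = 0")
  case True
  then show ?thesis using has_integral_const_real[of "1::complex" 0 "2*pi"]
    by (simp add: scaleR_conv_of_real)
next
  case False
  have "((\<lambda>t. cis (of_int k * t)) has_integral
      (cis (of_int k * (2*pi)) / (\<i> * of_int k) - cis (of_int k * 0) / (\<i> * of_int k))) {0..2*pi}"
  proof (rule fundamental_theorem_of_calculus)
    fix x assume "x \<in> {0..2*pi}"
    have "((\<lambda>t. exp (\<i> * of_real (of_int k * t)) / (\<i> * of_int k)) has_vector_derivative
        exp (\<i> * of_real (of_int k * x))) (at x within {0..2*pi})"
      using False
      by (auto intro!: derivative_eq_intros has_vector_derivative_real_field simp: field_simps)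
    then show "((\<lambda>t. cis (of_int k * t) / (\<i> * of_int k)) has_vector_derivative
        cis (of_int k * x)) (at x within {0..2*pi})"
      by (simp add: cis_conv_exp)
  qed simp
  moreover have "cis (of_int k * (2*pi)) = 1"
    using cis_multiple_2pi[of "of_int k"] by (simp add: mult.commute)
  ultimately show ?thesis using False by simp
qed

lemma maclaurin_parseval:
  assumes f: "f holomorphic_on \<U>" and r: "0 \<le> r" "r < 1"
  shows "(\<lambda>n. (cmod (maclaurin f n))\<^sup>2 * r ^ (2 * n)) sums
           (integral {0..2*pi} (\<lambda>t. (cmod (f (of_real r * cis t)))\<^sup>2) / (2 * pi))"
proof -
  define b where "b n = maclaurin f n * of_real r ^ n" for n
  define F where "F t = f (of_real r * cis t)" for t
  define S where "S N t = (\<Sum>n<N. b n * cis (real n * t))" for N t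
  obtain s where s: "r < s" "s < 1" using r dense by blast
  have smb: "summable (\<lambda>n. norm (b n))"
    unfolding b_def
    by (rule powser_insidea[OF sums_summable[OF maclaurin_sums[OF f, of "of_real s"]]])
       (use r s in auto)
  have S_F: "(\<lambda>n. b n * cis (real n * t)) sums F t" for t
  proof -
    have "b n * cis (real n * t) = maclaurin f n * (of_real r * cis t) ^ n" for n
      unfolding b_def power_mult_distrib Complex.DeMoivre mult.assoc ..
    then show ?thesis
      using maclaurin_sums[OF f, of "of_real r * cis t"] r by (simp add: F_def norm_mult)
  qed
  have "uniform_limit {0..2*pi} (\<lambda>N t. \<Sum>n<N. b n * cis (real n * t))
      (\<lambda>t. \<Sum>n. b n * cis (real n * t)) sequentially"
    by (rule Weierstrass_m_test[OF _ smb]) (simp add: norm_mult)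
  then have ul: "uniform_limit {0..2*pi} S F sequentially"
    unfolding S_def by (simp add: sums_unique[OF S_F, symmetric])
  have contS: "continuous_on {0..2*pi} (S N)" for N
    unfolding S_def by (intro continuous_intros)
  have contF: "continuous_on {0..2*pi} F"
    by (rule uniform_limit_theorem[OF _ ul]) (simp_all add: contS)
  have bF: "bounded (F ` {0..2*pi})"
    by (intro compact_imp_bounded compact_continuous_image contF) simp
  have ulc: "uniform_limit {0..2*pi} (\<lambda>N t. cnj (S N t)) (\<lambda>t. cnj (F t)) sequentially"
    using ul unfolding uniform_limit_iff
    by (simp add: dist_norm complex_cnj_diff[symmetric] del: complex_cnj_diff)
  have bcF: "bounded ((\<lambda>t. cnj (F t)) ` {0..2*pi})"
    using bF by (auto simp: bounded_iff)
  have ulp: "uniform_limit (cbox 0 (2*pi)) (\<lambda>N t. S N t * cnj (S N t)) (\<lambda>t. F t * cnj (F t))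
      sequentially"
    using uniform_lim_mult[OF ul ulc bF bcF] by simp
  obtain I J where IJ: "\<And>N. ((\<lambda>t. S N t * cnj (S N t)) has_integral I N) (cbox 0 (2*pi))"
      "((\<lambda>t. F t * cnj (F t)) has_integral J) (cbox 0 (2*pi))" "I \<longlonglongrightarrow> J"
    by (rule uniform_limit_integral_cbox[OF ulp]) (auto intro!: continuous_intros contS)
  have I: "I N = of_real (2 * pi * (\<Sum>n<N. (cmod (b n))\<^sup>2))" for N
  proof -
    have "((\<lambda>t. \<Sum>m<N. \<Sum>n<N. (b m * cnj (b n)) * cis (of_int (int m - int n) * t)) has_integral
        (\<Sum>m<N. \<Sum>n<N. (b m * cnj (b n)) *
           (if int m - int n = 0 then of_real (2 * pi) else 0))) {0..2*pi}"
      by (intro has_integral_sum has_integral_mult_right has_integral_cis finite_lessThan)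
    also have "(\<lambda>t. \<Sum>m<N. \<Sum>n<N. (b m * cnj (b n)) * cis (of_int (int m - int n) * t)) =
        (\<lambda>t. S N t * cnj (S N t))"
      by (simp add: S_def fun_eq_iff sum_product cis_cnj cis_mult algebra_simps)
    finally have "I N = (\<Sum>m<N. \<Sum>n<N. (b m * cnj (b n)) *
           (if int m - int n = 0 then of_real (2 * pi) else 0))"
      using has_integral_unique[OF IJ(1)[of N]] by simp
    also have "\<dots> = (\<Sum>m<N. (b m * cnj (b m)) * of_real (2 * pi))"
      by (intro sum.cong refl) (simp add: if_distrib cong: if_cong)
    also have "\<dots> = of_real (2 * pi * (\<Sum>n<N. (cmod (b n))\<^sup>2))"
      by (simp add: complex_norm_square sum_distrib_left mult.commute mult.left_commute
            del: of_real_power)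
    finally show ?thesis .
  qed
  have J: "J = of_real (integral {0..2*pi} (\<lambda>t. (cmod (F t))\<^sup>2))"
  proof -
    have "((\<lambda>t. of_real ((cmod (F t))\<^sup>2)) has_integral
        (of_real (integral {0..2*pi} (\<lambda>t. (cmod (F t))\<^sup>2)) :: complex)) {0..2*pi}"
      by (intro has_integral_of_real integrable_integral integrable_continuous_interval
            continuous_intros contF)
    then show ?thesis
      using IJ(2) unfolding complex_norm_square by (auto intro: has_integral_unique)
  qed
  have "(\<lambda>N. 2 * pi * (\<Sum>n<N. (cmod (b n))\<^sup>2)) \<longlonglongrightarrow>
      integral {0..2*pi} (\<lambda>t. (cmod (F t))\<^sup>2)"
    using IJ(3) unfolding I J by (simp only: tendsto_of_real_iff)
  then have "(\<lambda>N. (2 * pi * (\<Sum>n<N. (cmod (b n))\<^sup>2)) / (2 * pi)) \<longlonglongrightarrow>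
      integral {0..2*pi} (\<lambda>t. (cmod (F t))\<^sup>2) / (2 * pi)"
    by (intro tendsto_intros) auto
  moreover have "(cmod (b n))\<^sup>2 = (cmod (maclaurin f n))\<^sup>2 * r ^ (2 * n)" for n
    using r by (simp add: b_def norm_mult norm_power power_mult_distrib power_mult mult.commute)
  ultimately show ?thesis unfolding sums_def F_def by simp
qed

lemma maclaurin_mult_bounded:
  assumes phi: "\<phi> holomorphic_on \<U>" "\<And>z. z \<in> \<U> \<Longrightarrow> cmod (\<phi> z) \<le> M"
    and f: "f holomorphic_on \<U>" and sm: "summable (\<lambda>n. (cmod (maclaurin f n))\<^sup>2)"
  shows "summable (\<lambda>n. (cmod (maclaurin (\<lambda>z. \<phi> z * f z) n))\<^sup>2)" (is ?A)
    and "(\<Sum>n. (cmod (maclaurin (\<lambda>z. \<phi> z * f z) n))\<^sup>2) \<le>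
           M\<^sup>2 * (\<Sum>n. (cmod (maclaurin f n))\<^sup>2)" (is ?B)
proof -
  define g where "g z = \<phi> z * f z" for z
  have g: "g holomorphic_on \<U>"
    unfolding g_def by (intro holomorphic_intros phi f)
  define K where "K = M\<^sup>2 * (\<Sum>n. (cmod (maclaurin f n))\<^sup>2)"
  have cont: "continuous_on {0..2*pi} (\<lambda>t. (cmod (h (of_real r * cis t)))\<^sup>2)"
    if "h holomorphic_on \<U>" "0 \<le> r" "r < 1" for h r
  proof -
    have "continuous_on {0..2*pi} (\<lambda>t. h (of_real r * cis t))"
    proof (rule continuous_on_compose2[OF holomorphic_on_imp_continuous_on[OF that(1)]])
      show "continuous_on {0..2*pi} (\<lambda>t. of_real r * cis t)" by (intro continuous_intros)
      show "(\<lambda>t. of_real r * cis t) ` {0..2*pi} \<subseteq> \<U>" using that by (auto simp: norm_mult)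
    qed
    then show ?thesis by (intro continuous_on_power continuous_on_norm)
  qed
  have le_r: "(\<Sum>n<N. (cmod (maclaurin g n))\<^sup>2 * r ^ (2 * n)) \<le> K" if r: "0 \<le> r" "r < 1" for N r
  proof -
    have "(\<Sum>n<N. (cmod (maclaurin g n))\<^sup>2 * r ^ (2 * n)) \<le>
        (\<Sum>n. (cmod (maclaurin g n))\<^sup>2 * r ^ (2 * n))"
      by (rule sum_le_suminf[OF sums_summable[OF maclaurin_parseval[OF g r]]]) (use r in auto)
    also have "\<dots> = integral {0..2*pi} (\<lambda>t. (cmod (g (of_real r * cis t)))\<^sup>2) / (2 * pi)"
      using sums_unique[OF maclaurin_parseval[OF g r]] by simp
    also have "\<dots> \<le> integral {0..2*pi} (\<lambda>t. M\<^sup>2 * (cmod (f (of_real r * cis t)))\<^sup>2) / (2 * pi)"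
    proof (intro divide_right_mono integral_le integrable_continuous_interval cont g r
        continuous_on_mult continuous_on_const f)
      fix t
      have "cmod (\<phi> (of_real r * cis t)) \<le> M"
        using r by (intro phi) (simp add: norm_mult)
      then show "(cmod (g (of_real r * cis t)))\<^sup>2 \<le> M\<^sup>2 * (cmod (f (of_real r * cis t)))\<^sup>2"
        by (simp add: g_def norm_mult power_mult_distrib mult_right_mono power_mono)
    qed simp
    also have "\<dots> = M\<^sup>2 * (\<Sum>n. (cmod (maclaurin f n))\<^sup>2 * r ^ (2 * n))"
      by (simp add: sums_unique[OF maclaurin_parseval[OF f r], symmetric])
    also have "\<dots> \<le> K"
      unfolding K_def
    proof (intro mult_left_mono suminf_le sm sums_summable[OF maclaurin_parseval[OF f r]])
      fix n
      show "(cmod (maclaurin f n))\<^sup>2 * r ^ (2 * n) \<le> (cmod (maclaurin f n))\<^sup>2"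
        using r by (intro mult_left_le power_le_one) auto
    qed simp
    finally show ?thesis .
  qed
  have le: "(\<Sum>n<N. (cmod (maclaurin g n))\<^sup>2) \<le> K" for N
  proof (rule tendsto_upperbound)
    have "((\<lambda>r. \<Sum>n<N. (cmod (maclaurin g n))\<^sup>2 * r ^ (2 * n)) \<longlongrightarrow>
        (\<Sum>n<N. (cmod (maclaurin g n))\<^sup>2 * 1 ^ (2 * n))) (at_left (1::real))"
      by (intro tendsto_intros)
    then show "((\<lambda>r. \<Sum>n<N. (cmod (maclaurin g n))\<^sup>2 * r ^ (2 * n)) \<longlongrightarrow>
        (\<Sum>n<N. (cmod (maclaurin g n))\<^sup>2)) (at_left (1::real))" by simp
    show "\<forall>\<^sub>F r in at_left (1::real). (\<Sum>n<N. (cmod (maclaurin g n))\<^sup>2 * r ^ (2 * n)) \<le> K"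
      using eventually_at_left_real[of 0 "1::real"]
      by (auto elim!: eventually_mono intro!: le_r)
  qed simp
  have sg: "summable (\<lambda>n. (cmod (maclaurin g n))\<^sup>2)"
  proof (rule bounded_imp_summable)
    show "(\<Sum>k\<le>n. (cmod (maclaurin g k))\<^sup>2) \<le> K" for n
      using le[of "Suc n"] by (simp add: lessThan_Suc_atMost)
  qed simp
  have "(\<Sum>n. (cmod (maclaurin g n))\<^sup>2) \<le> K"
    using suminf_le_const[OF sg le] .
  with sg show ?A ?B unfolding g_def K_def .
qed

lemma
  assumes "\<phi> holomorphic_on \<U>" "bounded (\<phi> ` \<U>)"
  shows hardy2_fun_toeplitz:
      "hardy2_fun (toeplitz \<phi> h) = (\<lambda>z. if z \<in> \<U> then \<phi> z * hardy2_fun h z else 0)"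
    and bounded_linear_toeplitz: "bounded_linear (toeplitz \<phi>)"
    and toeplitz_scaleC: "toeplitz \<phi> (c *\<^sub>C h) = c *\<^sub>C toeplitz \<phi> h"
proof -
  obtain M where M: "\<And>z. z \<in> \<U> \<Longrightarrow> cmod (\<phi> z) \<le> M"
    using assms(2) unfolding bounded_iff by blast
  then have "0 \<le> M" using order_trans[OF norm_ge_zero M[of 0]] by simp
  note mb = maclaurin_mult_bounded[OF assms(1) M hardy2_holomorphic hardy2_summable]
  have mac: "maclaurin (\<lambda>z. if z \<in> \<U> then \<phi> z * hardy2_fun h z else 0) n =
      maclaurin (\<lambda>z. \<phi> z * hardy2_fun h z) n" for n h
    by (rule maclaurin_cong) simp
  have hf: "hardy2_fun (toeplitz \<phi> h) = (\<lambda>z. if z \<in> \<U> then \<phi> z * hardy2_fun h z else 0)" for h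
    unfolding toeplitz_def
  proof (rule Abs_hardy2_inverse, safe)
    have "(\<lambda>z. \<phi> z * hardy2_fun h z) holomorphic_on \<U>"
      by (intro holomorphic_intros assms hardy2_holomorphic)
    then show "(\<lambda>z. if z \<in> \<U> then \<phi> z * hardy2_fun h z else 0) holomorphic_on \<U>"
      by (rule holomorphic_transform) simp
    show "summable (\<lambda>n. (cmod (maclaurin
        (\<lambda>z. if z \<in> \<U> then \<phi> z * hardy2_fun h z else 0) n))\<^sup>2)"
      unfolding mac by (rule mb)
  qed simp
  show "hardy2_fun (toeplitz \<phi> h) = (\<lambda>z. if z \<in> \<U> then \<phi> z * hardy2_fun h z else 0)"
    by (rule hf)
  have sc: "toeplitz \<phi> (c *\<^sub>C h) = c *\<^sub>C toeplitz \<phi> h" for c h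
    by (subst hardy2_fun_inject[symmetric])
       (auto simp: hf scaleC_hardy2.rep_eq fun_eq_iff)
  show "toeplitz \<phi> (c *\<^sub>C h) = c *\<^sub>C toeplitz \<phi> h" by (rule sc)
  show "bounded_linear (toeplitz \<phi>)"
  proof
    show "toeplitz \<phi> (f + g) = toeplitz \<phi> f + toeplitz \<phi> g" for f g
      by (subst hardy2_fun_inject[symmetric])
         (auto simp: hf plus_hardy2.rep_eq fun_eq_iff algebra_simps)
    show "toeplitz \<phi> (r *\<^sub>R f) = r *\<^sub>R toeplitz \<phi> f" for r f
      by (simp add: scaleR_hardy2_def sc)
    have "norm (toeplitz \<phi> f) \<le> norm f * M" for f
    proof -
      have "norm (toeplitz \<phi> f) \<le> sqrt (M\<^sup>2 * (\<Sum>n. (cmod (maclaurin (hardy2_fun f) n))\<^sup>2))"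
        unfolding norm_hardy2_def hf mac by (intro real_sqrt_le_mono mb)
      then show ?thesis
        using \<open>0 \<le> M\<close> by (simp add: norm_hardy2_def real_sqrt_mult mult.commute)
    qed
    then show "\<exists>K. \<forall>f. norm (toeplitz \<phi> f) \<le> norm f * K" by blast
  qed
qed

section \<open>Intertwining, single covering and subordination\<close>

definition intertwines :: "(hardy2 \<Rightarrow> hardy2) \<Rightarrow> (hardy2 \<Rightarrow> hardy2) \<Rightarrow> bool" (infix \<open>\<propto>\<close> 50)
  where "A \<propto> B \<longleftrightarrow>
    (\<exists>X. bounded_linear X \<and> (\<forall>c h. X (c *\<^sub>C h) = c *\<^sub>C X h) \<and> X \<noteq> (\<lambda>h. 0) \<and> X \<circ> A = B \<circ> X)"

definition singly_covers :: "(complex \<Rightarrow> complex) \<Rightarrow> complex set \<Rightarrow> bool"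
  where "singly_covers \<phi> W \<longleftrightarrow>
    (\<exists>V\<subseteq>\<U>. inj_on \<phi> V \<and> \<phi> ` V = W \<and> {z \<in> \<U>. \<phi> z \<in> W} = V)"

definition subordinate_to :: "(complex \<Rightarrow> complex) \<Rightarrow> (complex \<Rightarrow> complex) \<Rightarrow> bool"
  where "subordinate_to \<psi> \<phi> \<longleftrightarrow>
    (\<exists>\<omega>. \<omega> holomorphic_on \<U> \<and> \<omega> ` \<U> \<subseteq> \<U> \<and> (\<forall>z\<in>\<U>. \<psi> z = \<phi> (\<omega> z)))"

end

theory Submission
  imports Defs
begin

text \<open>
  Let \<open>X\<close> be a nonzero operator with \<open>X T\<^sub>\<phi> = T\<^sub>\<psi> X\<close>. If \<open>\<psi> w = \<phi> v\<close>, the functional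
  \<open>h \<mapsto> (X h)(w)\<close> annihilates every multiple \<open>(\<phi> - \<phi> v) k\<close> with \<open>k\<close> in the Hardy space. In
  general such multiples do not exhaust, even up to closure, the functions that vanish at \<open>v\<close>.
  They do contain all bounded ones when \<open>\<phi> v\<close> lies in the singly covered open set \<open>W\<close>: a small
  closed disc about \<open>\<phi> v\<close> inside \<open>W\<close> has a compact preimage in the open unit disc, so \<open>\<phi> - \<phi> v\<close>
  is bounded away from zero near the unit circle, and its only zero, at \<open>v\<close>, is simple
  (\<open>bounded_quotient_singly_covered\<close>). Dividing \<open>z\<^sup>n - v\<^sup>n\<close> by \<open>\<phi> - \<phi> v\<close> gives
  \<open>(X z\<^sup>n)(w) = v\<^sup>n (X 1)(w)\<close> (\<open>intertwiner_power_at\<close>).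

  Hence on the open set where \<open>\<psi>\<close> takes values in \<open>W\<close> the local solution
  \<open>\<omega> = \<phi>\<^sup>-\<^sup>1 \<circ> \<psi>\<close> of \<open>\<psi> = \<phi> \<circ> \<omega>\<close> is the quotient of \<open>X z\<close> by \<open>X 1\<close>, and this quotient
  is meromorphic on the whole disc. Here \<open>X 1\<close> does not vanish identically, as otherwise \<open>X\<close>
  would kill all polynomials, which are dense. The identity
  \<open>(X z)\<^sup>n\<^sup>+\<^sup>1 = (X 1)\<^sup>n (X z\<^sup>n\<^sup>+\<^sup>1)\<close> extends from the open set to the disc. Since the
  monomials have norm one, for fixed \<open>w\<close> the numbers \<open>(X z\<^sup>n)(w)\<close> are bounded in \<open>n\<close>, and
  letting \<open>n\<close> grow yields \<open>\<bar>X z\<bar> \<le> \<bar>X 1\<bar>\<close> off the zeros of \<open>X 1\<close>. So the singularities of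
  \<open>\<omega>\<close> are removable and \<open>\<bar>\<omega>\<bar> \<le> 1\<close>. Where \<open>\<omega>\<close> is the local solution its values lie in the
  open disc, so the maximum principle makes the inequality strict everywhere, and \<open>\<psi> = \<phi> \<circ> \<omega>\<close>
  follows by analytic continuation.
\<close>

section \<open>Monomials and point evaluations in the Hardy space\<close>

lemma maclaurin_power: "maclaurin (\<lambda>z. z ^ k) n = (if n = k then 1 else 0)"
proof -
  have "(\<lambda>z::complex. z ^ k) has_fps_expansion fps_X ^ k"
    by (intro fps_expansion_intros)
  then have "fps_expansion (\<lambda>z::complex. z ^ k) 0 = fps_X ^ k"
    by (rule fps_expansion_eqI)
  then show ?thesis
    by (simp add: maclaurin_def)
qed

lemma maclaurin_power_on_disc:
  "maclaurin (\<lambda>z. if z \<in> \<U> then z ^ k else 0) n = (if n = k then 1 else 0)"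
  using maclaurin_cong[of "\<lambda>z. if z \<in> \<U> then z ^ k else 0" "\<lambda>z. z ^ k" n]
  by (simp add: maclaurin_power)

lift_definition hardy2_power :: "nat \<Rightarrow> hardy2" is "\<lambda>k z. if z \<in> \<U> then z ^ k else 0"
proof safe
  fix k
  show "(\<lambda>z::complex. if z \<in> \<U> then z ^ k else 0) holomorphic_on \<U>"
    by (rule holomorphic_transform[of "\<lambda>z. z ^ k"]) (auto intro!: holomorphic_intros)
  show "summable (\<lambda>n. (cmod (maclaurin (\<lambda>z. if z \<in> \<U> then z ^ k else 0) n))\<^sup>2)"
    unfolding maclaurin_power_on_disc
    by (rule summable_finite[of "{k}"]) auto
qed simp

lemma maclaurin_hardy2_power [simp]:
  "maclaurin (hardy2_fun (hardy2_power k)) n = (if n = k then 1 else 0)"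
  by (simp only: hardy2_power.rep_eq maclaurin_power_on_disc)

lemma norm_hardy2_power [simp]: "norm (hardy2_power k) = 1"
proof -
  have "(\<Sum>n. (cmod (maclaurin (hardy2_fun (hardy2_power k)) n))\<^sup>2) =
      (\<Sum>n\<in>{k}. (cmod (maclaurin (hardy2_fun (hardy2_power k)) n))\<^sup>2)"
    by (rule suminf_finite) auto
  then show ?thesis
    by (simp add: norm_hardy2_def)
qed

lemma hardy2_fun_diff: "hardy2_fun (f - g) z = hardy2_fun f z - hardy2_fun g z"
  by (simp add: minus_hardy2_def uminus_hardy2_def plus_hardy2.rep_eq scaleC_hardy2.rep_eq)

lemma maclaurin_hardy2_diff [simp]:
  "maclaurin (hardy2_fun (f - g)) n = maclaurin (hardy2_fun f) n - maclaurin (hardy2_fun g) n"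
  by (simp add: minus_hardy2_def uminus_hardy2_def)

lemma cmod_maclaurin_hardy2_le: "cmod (maclaurin (hardy2_fun f) n) \<le> norm f"
proof -
  have "(\<Sum>k\<in>{n}. (cmod (maclaurin (hardy2_fun f) k))\<^sup>2) \<le>
      (\<Sum>k. (cmod (maclaurin (hardy2_fun f) k))\<^sup>2)"
    by (intro sum_le_suminf hardy2_summable) auto
  then show ?thesis
    unfolding norm_hardy2_def by (intro real_le_rsqrt) simp
qed

text \<open>A coarse form of the boundedness of point evaluations: each Maclaurin coefficient is
  at most the norm, which is summed against the geometric series.\<close>

lemma cmod_hardy2_fun_le:
  assumes "z \<in> \<U>"
  shows "cmod (hardy2_fun f z) \<le> norm f / (1 - cmod z)"
proof -
  have z: "norm (cmod z) < 1"
    using assms by simp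
  have geo: "(\<lambda>n. norm f * cmod z ^ n) sums (norm f * (1 / (1 - cmod z)))"
    by (intro sums_mult geometric_sums z)
  have "cmod (hardy2_fun f z) \<le> norm f * (1 / (1 - cmod z))"
    by (rule norm_sums_le[OF maclaurin_sums[OF hardy2_holomorphic assms] geo])
       (simp add: norm_mult norm_power mult_right_mono cmod_maclaurin_hardy2_le)
  then show ?thesis
    by simp
qed

text \<open>The squared distance of a Maclaurin polynomial to the function is a tail of the
  convergent series of squared coefficients.\<close>

lemma hardy2_power_partial_sums:
  "(\<lambda>N. \<Sum>k<N. maclaurin (hardy2_fun h) k *\<^sub>C hardy2_power k) \<longlonglongrightarrow> h"
proof -
  define a where "a k = maclaurin (hardy2_fun h) k" for k
  define S where "S N = (\<Sum>k<N. a k *\<^sub>C hardy2_power k)" for N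
  have coeff_S: "maclaurin (hardy2_fun (S N)) n = (if n < N then a n else 0)" for n N
  proof (induction N)
    case 0
    then show ?case by (simp add: S_def zero_hardy2.rep_eq)
  next
    case (Suc N)
    have "S (Suc N) = S N + a N *\<^sub>C hardy2_power N" by (simp add: S_def)
    then have "maclaurin (hardy2_fun (S (Suc N))) n =
        maclaurin (hardy2_fun (S N)) n + a N * (if n = N then 1 else 0)"
      by (simp only: maclaurin_hardy2_add maclaurin_hardy2_scaleC maclaurin_hardy2_power)
    then show ?case unfolding Suc by (simp add: less_Suc_eq)
  qed
  have sm: "summable (\<lambda>n. (cmod (a n))\<^sup>2)"
    unfolding a_def by (rule hardy2_summable)
  have norm_tail: "norm (S N - h) = sqrt (\<Sum>n. (cmod (a (n + N)))\<^sup>2)" for N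
  proof -
    define b where "b n = (cmod (maclaurin (hardy2_fun (S N - h)) n))\<^sup>2" for n
    have b: "b n = (if n < N then 0 else (cmod (a n))\<^sup>2)" for n
      unfolding b_def maclaurin_hardy2_diff coeff_S by (simp add: a_def)
    have "summable b"
      unfolding b_def by (rule hardy2_summable)
    then have "suminf b = (\<Sum>n. b (n + N)) + (\<Sum>n<N. b n)"
      by (rule suminf_split_initial_segment)
    also have "(\<Sum>n<N. b n) = 0"
      by (intro sum.neutral) (simp add: b)
    also have "(\<Sum>n. b (n + N)) = (\<Sum>n. (cmod (a (n + N)))\<^sup>2)"
      by (simp add: b)
    finally show ?thesis
      unfolding norm_hardy2_def b_def by simp
  qed
  have "(\<lambda>N. sqrt (\<Sum>n. (cmod (a (n + N)))\<^sup>2)) \<longlonglongrightarrow> sqrt 0"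
  proof (intro tendsto_real_sqrt)
    show "(\<lambda>N. \<Sum>n. (cmod (a (n + N)))\<^sup>2) \<longlonglongrightarrow> 0"
      by (rule suminf_exist_split2[OF sm])
  qed
  then have "(\<lambda>N. norm (S N - h)) \<longlonglongrightarrow> 0"
    unfolding norm_tail real_sqrt_zero .
  then have "S \<longlonglongrightarrow> h"
    by (rule LIM_zero_cancel[OF tendsto_norm_zero_cancel])
  then show ?thesis
    unfolding S_def a_def .
qed

text \<open>By density of the polynomials, a continuous linear operator is determined by the images of
  the monomials.\<close>

lemma bounded_linear_eq_zero_if_powers:
  assumes X: "bounded_linear X" "\<And>c h. X (c *\<^sub>C h) = c *\<^sub>C X h"
    and pow0: "\<And>k. X (hardy2_power k) = 0"
  shows "X h = (0::hardy2)"
proof -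
  interpret bounded_linear X by fact
  have z: "c *\<^sub>C 0 = (0::hardy2)" for c
    by transfer simp
  have "X (\<Sum>k<N. maclaurin (hardy2_fun h) k *\<^sub>C hardy2_power k) = 0" for N
    by (simp add: sum X(2) pow0 z)
  moreover have "(\<lambda>N. X (\<Sum>k<N. maclaurin (hardy2_fun h) k *\<^sub>C hardy2_power k)) \<longlonglongrightarrow> X h"
    by (rule tendsto[OF hardy2_power_partial_sums])
  ultimately show ?thesis
    by (simp add: LIMSEQ_const_iff)
qed

section \<open>Division by a singly covered value\<close>

text \<open>Over \<open>W\<close> the function \<open>\<phi>\<close> has a holomorphic inverse, so the zero of \<open>\<phi> - \<phi> v\<close> at \<open>v\<close>
  is simple and the quotient has a removable singularity there. The quotient is bounded because
  the points where \<open>\<phi>\<close> is close to \<open>\<phi> v\<close> form a compact subset of the open disc, the image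
  of a closed disc under the inverse.\<close>

lemma bounded_quotient_singly_covered:
  assumes \<phi>: "\<phi> holomorphic_on \<U>" and W: "open W" "singly_covers \<phi> W"
    and v: "v \<in> \<U>" "\<phi> v \<in> W"
    and f: "f holomorphic_on \<U>" "bounded (f ` \<U>)" "f v = 0"
  obtains q where "q holomorphic_on \<U>" "bounded (q ` \<U>)"
    "\<And>z. z \<in> \<U> \<Longrightarrow> f z = (\<phi> z - \<phi> v) * q z"
proof -
  define V where "V = {z \<in> \<U>. \<phi> z \<in> W}"
  have inj: "inj_on \<phi> V" and img: "\<phi> ` V = W"
    using W(2) by (auto simp: singly_covers_def V_def)
  have contV: "continuous_on \<U> \<phi>"
    using \<phi> by (rule holomorphic_on_imp_continuous_on)
  have "open V"
    using continuous_open_preimage[OF contV _ W(1)] by (simp add: V_def vimage_def Int_def)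
  have V\<U>: "V \<subseteq> \<U>" and vV: "v \<in> V"
    using v by (auto simp: V_def)
  obtain g where g: "g holomorphic_on W" "\<And>z. z \<in> V \<Longrightarrow> deriv \<phi> z * deriv g (\<phi> z) = 1"
      "\<And>z. z \<in> V \<Longrightarrow> g (\<phi> z) = z"
    using holomorphic_has_inverse[OF holomorphic_on_subset[OF \<phi> V\<U>] \<open>open V\<close> inj]
    unfolding img by metis
  (* Both f and \<phi> - \<phi> v are divided by z - v; the zero of the denominator disappears. *)
  define F where "F z = (if z = v then deriv f v else (f z - f v) / (z - v))" for z
  define P where "P z = (if z = v then deriv \<phi> v else (\<phi> z - \<phi> v) / (z - v))" for z
  have F: "F holomorphic_on \<U>" and P: "P holomorphic_on \<U>"
    unfolding F_def P_def by (rule pole_lemma_open; use f \<phi> in simp)+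
  have only_v: "z = v" if "z \<in> \<U>" "\<phi> z = \<phi> v" for z
    using inj_onD[OF inj that(2)] that vV v by (auto simp: V_def)
  have P0: "P z \<noteq> 0" if "z \<in> \<U>" for z
    using only_v[OF that] g(2)[OF vV] by (auto simp: P_def)
  define q where "q z = F z / P z" for z
  have q: "q holomorphic_on \<U>"
    unfolding q_def by (intro holomorphic_intros F P P0)
  have fq: "f z = (\<phi> z - \<phi> v) * q z" if "z \<in> \<U>" for z
    using only_v[OF that] by (auto simp: q_def F_def P_def f(3))
  obtain \<delta> where \<delta>: "\<delta> > 0" "cball (\<phi> v) \<delta> \<subseteq> W"
    using W(1) v(2) open_contains_cball by blast
  define K where "K = g ` cball (\<phi> v) \<delta>"
  have "continuous_on (cball (\<phi> v) \<delta>) g"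
    using holomorphic_on_imp_continuous_on[OF g(1)] \<delta>(2) by (rule continuous_on_subset)
  then have "compact K"
    unfolding K_def by (intro compact_continuous_image) auto
  have "K \<subseteq> V"
    using \<delta>(2) img g(3) by (force simp: K_def)
  then have "K \<subseteq> \<U>"
    using V\<U> by blast
  have "bounded (q ` K)"
    by (intro compact_imp_bounded compact_continuous_image \<open>compact K\<close>
        continuous_on_subset[OF holomorphic_on_imp_continuous_on[OF q] \<open>K \<subseteq> \<U>\<close>])
  then obtain B where B: "\<And>z. z \<in> K \<Longrightarrow> cmod (q z) \<le> B"
    by (auto simp: bounded_iff)
  obtain C where C: "\<And>z. z \<in> \<U> \<Longrightarrow> cmod (f z) \<le> C"
    using f(2) unfolding bounded_iff by blast
  have "cmod (q z) \<le> max B (C / \<delta>)" if z: "z \<in> \<U>" for z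
  proof (cases "z \<in> K")
    case True
    then show ?thesis using B by (simp add: le_max_iff_disj)
  next
    case False
    have "\<phi> z \<notin> cball (\<phi> v) \<delta>"
    proof
      assume *: "\<phi> z \<in> cball (\<phi> v) \<delta>"
      then have "z \<in> V" using \<delta>(2) z by (auto simp: V_def)
      then show False using g(3)[of z] * False by (force simp: K_def)
    qed
    then have far: "\<delta> \<le> cmod (\<phi> z - \<phi> v)"
      by (simp add: dist_norm norm_minus_commute)
    have "\<delta> * cmod (q z) \<le> cmod (\<phi> z - \<phi> v) * cmod (q z)"
      using far by (intro mult_right_mono) auto
    also have "\<dots> \<le> C"
      using C[OF z] fq[OF z] by (simp add: norm_mult)
    finally show ?thesis
      using \<delta>(1) by (simp add: le_max_iff_disj field_simps)
  qed
  then have "bounded (q ` \<U>)"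
    by (intro boundedI, elim imageE) simp
  with q fq show thesis
    using that by blast
qed

section \<open>Point evaluations of an intertwining operator\<close>

text \<open>Write \<open>z\<^sup>n - v\<^sup>n\<close> as \<open>(\<phi> - \<psi> w) k\<close> with \<open>k\<close> in the Hardy space. By the intertwining
  relation \<open>X\<close> sends this to \<open>(\<psi> - \<psi> w) (X k)\<close>, which vanishes at \<open>w\<close>.\<close>

lemma intertwiner_power_at:
  assumes \<phi>: "\<phi> holomorphic_on \<U>" "bounded (\<phi> ` \<U>)"
    and \<psi>: "\<psi> holomorphic_on \<U>" "bounded (\<psi> ` \<U>)"
    and W: "open W" "singly_covers \<phi> W"
    and X: "bounded_linear X" "\<And>c h. X (c *\<^sub>C h) = c *\<^sub>C X h"
    and XT: "\<And>h. X (toeplitz \<phi> h) = toeplitz \<psi> (X h)"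
    and wv: "w \<in> \<U>" "v \<in> \<U>" "\<phi> v = \<psi> w" "\<psi> w \<in> W"
  shows "hardy2_fun (X (hardy2_power n)) w = v ^ n * hardy2_fun (X (hardy2_power 0)) w"
proof -
  interpret bounded_linear X by fact
  have "(\<lambda>z. z ^ n - v ^ n) holomorphic_on \<U>"
    by (intro holomorphic_intros)
  moreover have "bounded ((\<lambda>z. z ^ n - v ^ n) ` \<U>)"
  proof -
    have "bounded ((\<lambda>z. z ^ n - v ^ n) ` cball 0 1)"
      by (intro compact_imp_bounded compact_continuous_image continuous_intros) auto
    then show ?thesis
      by (rule bounded_subset) auto
  qed
  ultimately obtain q where q: "q holomorphic_on \<U>" "bounded (q ` \<U>)"
    "\<And>z. z \<in> \<U> \<Longrightarrow> z ^ n - v ^ n = (\<phi> z - \<phi> v) * q z"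
    using bounded_quotient_singly_covered[OF \<phi>(1) W wv(2), of "\<lambda>z. z ^ n - v ^ n"] wv(3,4)
    by auto
  (* Applied to the constant function 1, the Toeplitz operator turns the bounded function q
     into an element of the Hardy space. *)
  define k where "k = toeplitz q (hardy2_power 0)"
  have "hardy2_power n - v ^ n *\<^sub>C hardy2_power 0 = toeplitz \<phi> k - \<psi> w *\<^sub>C k"
    unfolding hardy2_fun_inject[symmetric] k_def using q(3) wv(3)
    by (auto simp: fun_eq_iff hardy2_fun_diff scaleC_hardy2.rep_eq hardy2_power.rep_eq
        hardy2_fun_toeplitz[OF \<phi>] hardy2_fun_toeplitz[OF q(1,2)] algebra_simps)
  then have "X (hardy2_power n) - v ^ n *\<^sub>C X (hardy2_power 0) =
      toeplitz \<psi> (X k) - \<psi> w *\<^sub>C X k"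
    by (metis X(2) XT diff)
  then have "hardy2_fun (X (hardy2_power n) - v ^ n *\<^sub>C X (hardy2_power 0)) w =
      hardy2_fun (toeplitz \<psi> (X k) - \<psi> w *\<^sub>C X k) w"
    by simp
  also have "\<dots> = 0"
    using wv(1) by (simp add: hardy2_fun_diff scaleC_hardy2.rep_eq hardy2_fun_toeplitz[OF \<psi>])
  finally show ?thesis
    by (simp add: hardy2_fun_diff scaleC_hardy2.rep_eq)
qed

section \<open>Contractive quotients of holomorphic functions\<close>

lemma le_if_powers_bounded:
  fixes x a C :: real
  assumes "0 < a" "\<And>n. x ^ Suc n \<le> C * a ^ n"
  shows "x \<le> a"
proof (rule ccontr)
  assume "\<not> x \<le> a"
  then have "1 < x / a" using assms(1) by simp
  then obtain n where n: "C / a < (x / a) ^ n"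
    using real_arch_pow by blast
  also have "\<dots> \<le> (x / a) ^ Suc n"
    using \<open>1 < x / a\<close> by (intro power_increasing) auto
  also have "\<dots> \<le> C / a"
    using assms(2)[of n] assms(1) by (simp add: power_divide field_simps)
  finally show False by simp
qed

text \<open>The zeros of \<open>q\<close> may be infinite in number, so the singularities of the quotient are removed
  locally: each zero is isolated, and the quotient is bounded near it.\<close>

lemma holomorphic_contractive_quotient:
  assumes S: "open S" "connected S" and p: "p holomorphic_on S" and q: "q holomorphic_on S"
    and \<beta>: "\<beta> \<in> S" "q \<beta> \<noteq> 0"
    and le: "\<And>z. z \<in> S \<Longrightarrow> q z \<noteq> 0 \<Longrightarrow> cmod (p z) \<le> cmod (q z)"
  obtains \<omega> where "\<omega> holomorphic_on S" "\<And>z. z \<in> S \<Longrightarrow> q z \<noteq> 0 \<Longrightarrow> \<omega> z = p z / q z"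
    "\<And>z. z \<in> S \<Longrightarrow> cmod (\<omega> z) \<le> 1"
proof -
  define f where "f z = p z / q z" for z
  define \<omega> where "\<omega> = remove_sings f"
  have f1: "cmod (f z) \<le> 1" if "z \<in> S" "q z \<noteq> 0" for z
    using le[OF that] that by (simp add: f_def norm_divide)
  have local: "\<omega> analytic_on {z} \<and> cmod (\<omega> z) \<le> 1" if "z \<in> S" for z
  proof -
    have "\<forall>\<^sub>F w in at z. q w \<noteq> 0 \<and> w \<in> S"
      by (rule non_zero_neighbour_alt[OF q S that \<beta>])
    then obtain r where r: "r > 0" "\<And>w. w \<in> ball z r - {z} \<Longrightarrow> q w \<noteq> 0 \<and> w \<in> S"
      unfolding eventually_at by (auto simp: dist_commute)
    have hol: "f holomorphic_on ball z r - {z}"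
      unfolding f_def
    proof (rule holomorphic_on_divide)
      have "ball z r - {z} \<subseteq> S" using r(2) by blast
      then show "p holomorphic_on ball z r - {z}" "q holomorphic_on ball z r - {z}"
        using p q holomorphic_on_subset by blast+
    qed (use r(2) in blast)
    have ev: "\<forall>\<^sub>F w in at z. cmod (f w) \<le> 1"
      unfolding eventually_at using r f1 by (intro exI[of _ r]) (auto simp: dist_commute)
    obtain g where g: "g holomorphic_on ball z r" "\<And>w. w \<in> ball z r - {z} \<Longrightarrow> g w = f w"
      using holomorphic_on_extend_bounded[OF hol] ev r(1) by (auto simp: interior_open)
    have "g \<midarrow>z\<rightarrow> g z"
      using g(1) r(1) by (meson centre_in_ball continuous_on_eq_continuous_at
          holomorphic_on_imp_continuous_on isContD open_ball)
    moreover have "\<forall>\<^sub>F w in at z. g w = f w"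
      unfolding eventually_at using g(2) r(1) by (intro exI[of _ r]) (simp add: dist_commute)
    ultimately have c: "f \<midarrow>z\<rightarrow> g z"
      by (rule Lim_transform_eventually)
    have "isolated_singularity_at f z"
      unfolding isolated_singularity_at_def using hol r(1)
      by (intro exI[of _ r]) (simp add: analytic_on_open open_delete)
    then have "\<omega> analytic_on {z}"
      unfolding \<omega>_def using c by (rule remove_sings_analytic_at)
    moreover have "\<omega> z = g z"
      unfolding \<omega>_def using c by (rule remove_sings_eqI)
    moreover have "cmod (g z) \<le> 1"
      by (rule Lim_norm_ubound[OF _ c ev]) simp
    ultimately show ?thesis by simp
  qed
  have val: "\<omega> z = p z / q z" if "z \<in> S" "q z \<noteq> 0" for z
  proof -
    have "f analytic_on {z}"
      unfolding f_def using p q S(1) that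
      by (intro analytic_on_divide) (auto simp: analytic_at)
    then show ?thesis
      by (simp add: \<omega>_def f_def)
  qed
  have "\<omega> holomorphic_on S"
    using local analytic_imp_holomorphic analytic_on_analytic_at by blast
  with val local show thesis
    using that by blast
qed

lemma maximum_modulus_unit_disc:
  assumes S: "open S" "connected S" and \<omega>: "\<omega> holomorphic_on S"
    and le: "\<And>z. z \<in> S \<Longrightarrow> cmod (\<omega> z) \<le> 1"
    and \<beta>: "\<beta> \<in> S" "cmod (\<omega> \<beta>) < 1" and z: "z \<in> S"
  shows "cmod (\<omega> z) < 1"
proof (rule ccontr)
  assume "\<not> cmod (\<omega> z) < 1"
  then have z1: "cmod (\<omega> z) = 1" using le[OF z] by simp
  have "\<omega> constant_on S"
    by (rule maximum_modulus_principle[OF \<omega> S S(1) order_refl z]) (simp add: z1 le)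
  then show False
    using z1 \<beta> z by (auto simp: constant_on_def)
qed

theorem theorem4p2:
  fixes \<phi> \<psi> :: "complex \<Rightarrow> complex"
  assumes "\<phi> holomorphic_on \<U>" and "bounded (\<phi> ` \<U>)"
    and "\<psi> holomorphic_on \<U>" and "bounded (\<psi> ` \<U>)"
    and "\<exists>W. open W \<and> W \<noteq> {} \<and> W \<subseteq> \<phi> ` \<U> \<and> singly_covers \<phi> W \<and> W \<inter> \<psi> ` \<U> \<noteq> {}"
    and "toeplitz \<phi> \<propto> toeplitz \<psi>"
  shows "subordinate_to \<psi> \<phi> \<and> \<psi> ` \<U> \<subseteq> \<phi> ` \<U>"
proof -
  note \<phi> = assms(1,2) and \<psi> = assms(3,4)
  obtain W where W: "open W" "W \<subseteq> \<phi> ` \<U>" "singly_covers \<phi> W" "W \<inter> \<psi> ` \<U> \<noteq> {}"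
    using assms(5) by blast
  obtain X where X: "bounded_linear X" "\<And>c h. X (c *\<^sub>C h) = c *\<^sub>C X h" "X \<noteq> (\<lambda>h. 0)"
      and XT: "\<And>h. X (toeplitz \<phi> h) = toeplitz \<psi> (X h)"
    using assms(6) unfolding intertwines_def by (metis comp_apply)
  define G where "G = {w \<in> \<U>. \<psi> w \<in> W}"
  have "open G"
    using continuous_open_preimage[OF holomorphic_on_imp_continuous_on[OF \<psi>(1)] _ W(1)]
    by (simp add: G_def vimage_def Int_def)
  have "G \<noteq> {}" "G \<subseteq> \<U>"
    using W(4) by (auto simp: G_def)
  have ident: "f z = g z"
    if "open A" "A \<noteq> {}" "A \<subseteq> \<U>" "f holomorphic_on \<U>" "g holomorphic_on \<U>"
       "\<And>w. w \<in> A \<Longrightarrow> f w = g w" "z \<in> \<U>" for f g :: "complex \<Rightarrow> complex" and A z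
    by (rule analytic_continuation_open[OF that(1) open_ball that(2) connected_ball that(3-7)])
  define a where "a n = hardy2_fun (X (hardy2_power n))" for n
  have a_holo: "a n holomorphic_on \<U>" for n
    unfolding a_def by (rule hardy2_holomorphic)
  have "\<exists>v. \<forall>w\<in>G. v w \<in> \<U> \<and> \<phi> (v w) = \<psi> w"
    using W(2) by (intro bchoice) (force simp: G_def)
  then obtain v where v: "\<And>w. w \<in> G \<Longrightarrow> v w \<in> \<U>" "\<And>w. w \<in> G \<Longrightarrow> \<phi> (v w) = \<psi> w"
    by blast
  have aG: "a n w = v w ^ n * a 0 w" if "w \<in> G" for n w
    unfolding a_def
    by (rule intertwiner_power_at[OF \<phi> \<psi> W(1,3) X(1,2) XT])
       (use that v in \<open>auto simp: G_def\<close>)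
  (* Vanishing of X 1 on G would propagate to all the images of monomials, then to the disc. *)
  have "\<exists>\<beta>\<in>G. a 0 \<beta> \<noteq> 0"
  proof (rule ccontr)
    assume "\<not> (\<exists>\<beta>\<in>G. a 0 \<beta> \<noteq> 0)"
    then have "a n w = 0" if "w \<in> G" for n w
      using aG[OF that, of n] that by simp
    then have zU: "a n w = 0" if "w \<in> \<U>" for n w
      using ident[OF \<open>open G\<close> \<open>G \<noteq> {}\<close> \<open>G \<subseteq> \<U>\<close> a_holo, of "\<lambda>_. 0"] that by auto
    have "X (hardy2_power n) = 0" for n
    proof (rule hardy2_eqI)
      show "maclaurin (hardy2_fun (X (hardy2_power n))) m = maclaurin (hardy2_fun 0) m" for m
        by (rule maclaurin_cong) (use zU in \<open>simp add: a_def zero_hardy2.rep_eq\<close>)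
    qed
    then have "X h = 0" for h
      by (rule bounded_linear_eq_zero_if_powers[OF X(1,2)])
    with X(3) show False by blast
  qed
  then obtain \<beta> where \<beta>: "\<beta> \<in> G" "a 0 \<beta> \<noteq> 0" by blast
  then have "\<beta> \<in> \<U>" using \<open>G \<subseteq> \<U>\<close> by blast
  have a_pow: "a 1 w ^ Suc n = a (Suc n) w * a 0 w ^ n" if "w \<in> \<U>" for n w
  proof (rule ident[OF \<open>open G\<close> \<open>G \<noteq> {}\<close> \<open>G \<subseteq> \<U>\<close> _ _ _ that])
    show "a 1 z ^ Suc n = a (Suc n) z * a 0 z ^ n" if "z \<in> G" for z
      by (simp add: aG[OF that, of 1] aG[OF that, of "Suc n"] power_mult_distrib del: One_nat_def)
  qed (intro holomorphic_intros a_holo)+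
  obtain K where K: "\<And>h. norm (X h) \<le> norm h * K"
    using bounded_linear.bounded[OF X(1)] by blast
  have "cmod (a 1 w) \<le> cmod (a 0 w)" if w: "w \<in> \<U>" "a 0 w \<noteq> 0" for w
  proof (rule le_if_powers_bounded)
    fix n
    have "cmod (a (Suc n) w) \<le> norm (X (hardy2_power (Suc n))) / (1 - cmod w)"
      unfolding a_def by (rule cmod_hardy2_fun_le[OF w(1)])
    also have "\<dots> \<le> K / (1 - cmod w)"
      using K[of "hardy2_power (Suc n)"] w by (intro divide_right_mono) auto
    finally have "cmod (a (Suc n) w) * cmod (a 0 w) ^ n \<le> K / (1 - cmod w) * cmod (a 0 w) ^ n"
      by (rule mult_right_mono) simp
    moreover have "cmod (a 1 w) ^ Suc n = cmod (a (Suc n) w) * cmod (a 0 w) ^ n"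
      using a_pow[OF w(1), of n] by (metis norm_mult norm_power)
    ultimately show "cmod (a 1 w) ^ Suc n \<le> K / (1 - cmod w) * cmod (a 0 w) ^ n"
      by simp
  qed (use w in simp)
  then obtain \<omega> where \<omega>: "\<omega> holomorphic_on \<U>" "\<And>z. z \<in> \<U> \<Longrightarrow> a 0 z \<noteq> 0 \<Longrightarrow> \<omega> z = a 1 z / a 0 z"
    "\<And>z. z \<in> \<U> \<Longrightarrow> cmod (\<omega> z) \<le> 1"
    using holomorphic_contractive_quotient[OF open_ball connected_ball a_holo a_holo \<open>\<beta> \<in> \<U>\<close> \<beta>(2)]
    by metis
  (* On A the globally defined quotient is the local inverse branch of \<phi> applied to \<psi>, which
     takes values in the open disc. *)
  define A where "A = {w \<in> G. a 0 w \<noteq> 0}"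
  have \<omega>v: "\<omega> w = v w" if "w \<in> A" for w
    using \<omega>(2)[of w] that aG[of w 1] \<open>G \<subseteq> \<U>\<close> by (auto simp: A_def)
  have "open A"
    using continuous_open_preimage[OF holomorphic_on_imp_continuous_on[OF
          holomorphic_on_subset[OF a_holo \<open>G \<subseteq> \<U>\<close>]] \<open>open G\<close>, of "- {0}" 0]
    by (simp add: A_def vimage_def Int_def open_Compl)
  have "A \<noteq> {}" "A \<subseteq> \<U>"
    using \<beta> \<open>G \<subseteq> \<U>\<close> by (auto simp: A_def)
  have "cmod (\<omega> \<beta>) < 1"
    using \<omega>v[of \<beta>] v(1)[of \<beta>] \<beta> by (simp add: A_def)
  then have \<omega>1: "\<omega> z \<in> \<U>" if "z \<in> \<U>" for z
    using maximum_modulus_unit_disc[OF open_ball connected_ball \<omega>(1,3) \<open>\<beta> \<in> \<U>\<close> _ that] by simp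
  have \<psi>\<omega>: "\<psi> z = \<phi> (\<omega> z)" if "z \<in> \<U>" for z
  proof (rule ident[OF \<open>open A\<close> \<open>A \<noteq> {}\<close> \<open>A \<subseteq> \<U>\<close> \<psi>(1) _ _ that])
    show "(\<lambda>z. \<phi> (\<omega> z)) holomorphic_on \<U>"
      using holomorphic_on_compose_gen[OF \<omega>(1) \<phi>(1)] \<omega>1 by (simp add: o_def image_subset_iff)
    show "\<psi> w = \<phi> (\<omega> w)" if "w \<in> A" for w
      using \<omega>v[OF that] v(2)[of w] that by (simp add: A_def)
  qed
  show ?thesis
    using \<omega>(1) \<omega>1 \<psi>\<omega> unfolding subordinate_to_def by (auto intro!: exI[of _ \<omega>])
qed

end
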